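(* Let $Q$ be a finite quandle and let $\rho : Q \to GL(V)$ be a finite dimensional quandle representation over $\mathbb{C}$. Then $\rho$ is completely reducible if and only if every element of $\rho(Q)$ is diagonalizable.
   Context: A quandle is a set $Q$ with a binary operation $\triangleright$ such that: $x\triangleright x=x$ for all $x\in Q$; for all $x,y\in Q$ there is a unique $z\in Q$ with $x\triangleright z=y$; and $x\triangleright(y\triangleright z)=(x\triangleright y)\triangleright(x\triangleright z)$ for all $x,y,z\in Q$. A quandle representation of $Q$ on a vector space $V$ is a map $\rho:Q\to GL(V)$ with $\rho(x\triangleright y)=\rho(x)\rho(y)\rho(x)^{-1}$ for all $x,y\in Q$. A subrepresentation is a vector subspace $W\subset V$ stable under all elements of $\rho(Q)$. A representation (or subrepresentation) is irreducible if it has no subrepresentations other than $0$ and itself. A quandle representation is completely reducible if it can be decomposed as a direct sum of irreducible subrepresentations. *)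

theory Defs
  imports Complex_Main
begin

locale quandle =
  fixes Q :: "'q set" and qop :: "'q \<Rightarrow> 'q \<Rightarrow> 'q" (infixl "\<rhd>" 70)
  assumes closed: "x \<in> Q \<Longrightarrow> y \<in> Q \<Longrightarrow> x \<rhd> y \<in> Q"
    and idem: "x \<in> Q \<Longrightarrow> x \<rhd> x = x"
    and left_div: "x \<in> Q \<Longrightarrow> y \<in> Q \<Longrightarrow> \<exists>!z. z \<in> Q \<and> x \<rhd> z = y"
    and left_distrib: "x \<in> Q \<Longrightarrow> y \<in> Q \<Longrightarrow> z \<in> Q \<Longrightarrow> x \<rhd> (y \<rhd> z) = (x \<rhd> y) \<rhd> (x \<rhd> z)"

context vector_space
begin

definition general_linear :: "('b \<Rightarrow> 'b) set" where
  "general_linear = {f. Vector_Spaces.linear scale scale f \<and> bij f}"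

definition diagonalizable :: "('b \<Rightarrow> 'b) \<Rightarrow> bool" where
  "diagonalizable f \<longleftrightarrow>
    (\<exists>B. independent B \<and> span B = UNIV \<and> (\<forall>b\<in>B. \<exists>c. f b = scale c b))"

text \<open>
  The space is the internal direct sum of the subspaces in \<open>\<W>\<close>: every vector is in exactly one
  way a finitely supported sum of components \<open>w U \<in> U\<close>. Summands are indexed by themselves, which
  loses nothing, since two equal summands of an internal direct sum are zero.
\<close>
definition direct_sum_decomposition :: "'b set set \<Rightarrow> bool" where
  "direct_sum_decomposition \<W> \<longleftrightarrow>
    (\<forall>U\<in>\<W>. subspace U) \<and>
    (\<forall>v. \<exists>!w. (\<forall>U\<in>\<W>. w U \<in> U) \<and> (\<forall>U. U \<notin> \<W> \<longrightarrow> w U = 0) \<and>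
       finite {U. w U \<noteq> 0} \<and> v = (\<Sum>U | w U \<noteq> 0. w U))"

end

locale quandle_representation = quandle Q qop + vector_space scale
  for Q :: "'q set" and qop :: "'q \<Rightarrow> 'q \<Rightarrow> 'q" (infixl "\<rhd>" 70)
    and scale :: "'k::field \<Rightarrow> 'v::ab_group_add \<Rightarrow> 'v" +
  fixes \<rho> :: "'q \<Rightarrow> 'v \<Rightarrow> 'v"
  assumes rep_GL: "x \<in> Q \<Longrightarrow> \<rho> x \<in> general_linear"
    and rep_conj: "x \<in> Q \<Longrightarrow> y \<in> Q \<Longrightarrow> \<rho> (x \<rhd> y) = \<rho> x \<circ> \<rho> y \<circ> inv (\<rho> x)"
begin

definition subrepresentation :: "'v set \<Rightarrow> bool" where
  "subrepresentation W \<longleftrightarrow> subspace W \<and> (\<forall>f\<in>\<rho> ` Q. f ` W \<subseteq> W)"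

text \<open>
  The zero subrepresentation counts as irreducible. This has no effect on complete reducibility,
  because zero summands can be dropped from a direct sum.
\<close>
definition irreducible_subrepresentation :: "'v set \<Rightarrow> bool" where
  "irreducible_subrepresentation W \<longleftrightarrow>
    subrepresentation W \<and> (\<forall>U. subrepresentation U \<and> U \<subseteq> W \<longrightarrow> U = {0} \<or> U = W)"

definition completely_reducible :: bool where
  "completely_reducible \<longleftrightarrow>
    (\<exists>\<W>. (\<forall>W\<in>\<W>. irreducible_subrepresentation W) \<and> direct_sum_decomposition \<W>)"

end

end

theory Submission
  imports Defs "HOL-Computational_Algebra.Fundamental_Theorem_Algebra"
begin

text \<open>
  Since \<open>Q\<close> is finite, some power \<open>N > 0\<close> makes every \<open>\<rho> x ^^ N\<close> commute with all of
  \<open>\<rho> ` Q\<close>. On an irreducible summand \<open>\<rho> x ^^ N\<close> is then a nonzero scalar \<open>c\<close> by Schur's lemma, so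
  \<open>\<rho> x\<close> is annihilated by the separable polynomial \<open>t ^ N - c\<close> and is diagonalizable.
  Conversely, if all \<open>\<rho> x\<close> are diagonalizable, joint eigenvectors of the powers \<open>\<rho> x ^^ N\<close> span the
  space, so each subrepresentation is the image of a projection \<open>p\<close> commuting with these powers.
  Conjugation by \<open>\<rho> x\<close> has order dividing \<open>N\<close> on such maps, so the words in \<open>\<rho> ` Q\<close> produce only finitely
  many conjugates of \<open>p\<close>; their average is an equivariant projection, whose kernel is an invariant
  complement.
\<close>

subsection \<open>Spanning by eigenvectors\<close>

context vector_space
begin

text \<open>For linear \<open>f\<close> the zero vector belongs to this set, which does not affect
  its span.\<close>

definition eigenvectors :: "('b \<Rightarrow> 'b) \<Rightarrow> 'b set" where
  "eigenvectors f = {v. \<exists>c. f v = scale c v}"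

end

context vector_space
begin

text \<open>A maximal independent set of eigenvectors is a basis as soon as the eigenvectors span.
  The spanning condition is easier to carry over to powers and to invariant subspaces than a chosen
  basis.\<close>

lemma diagonalizable_iff_span_eigenvectors:
  "diagonalizable f \<longleftrightarrow> span (eigenvectors f) = UNIV"
proof
  assume "diagonalizable f"
  then obtain B where B: "span B = UNIV" "B \<subseteq> eigenvectors f"
    by (auto simp: diagonalizable_def eigenvectors_def)
  show "span (eigenvectors f) = UNIV"
    using span_mono[OF B(2)] B(1) by auto
next
  assume *: "span (eigenvectors f) = UNIV"
  obtain B where B: "B \<subseteq> eigenvectors f" "independent B" "eigenvectors f \<subseteq> span B"
    using maximal_independent_subset by blast
  have "span B = UNIV"
    using span_minimal[OF B(3) subspace_span] * by auto
  with B show "diagonalizable f"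
    by (auto simp: diagonalizable_def eigenvectors_def)
qed

lemma linear_funpow:
  "Vector_Spaces.linear scale scale f \<Longrightarrow> Vector_Spaces.linear scale scale (f ^^ n)"
proof (induction n)
  case 0
  then show ?case
    by (simp add: Vector_Spaces.linear_iff vector_space_axioms)
next
  case (Suc n)
  then show ?case
    by (simp add: Vector_Spaces.linear_iff)
qed

lemma eigenvectors_funpow:
  assumes "Vector_Spaces.linear scale scale f"
  shows "eigenvectors f \<subseteq> eigenvectors (f ^^ n)"
proof
  fix v assume "v \<in> eigenvectors f"
  then obtain c where c: "f v = scale c v"
    by (auto simp: eigenvectors_def)
  have "(f ^^ n) v = scale (c ^ n) v"
    using assms by (induction n) (simp_all add: Vector_Spaces.linear_iff c mult.commute)
  then show "v \<in> eigenvectors (f ^^ n)"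
    by (auto simp: eigenvectors_def)
qed

text \<open>Applying \<open>f - \<mu>\<close> to the sum removes the component of eigenvalue \<open>\<mu>\<close> and
  rescales the others by nonzero factors.\<close>
lemma eigenvector_component_mem:
  assumes f: "Vector_Spaces.linear scale scale f" and X: "subspace X" "f ` X \<subseteq> X"
    and "finite S" "\<And>c. c \<in> S \<Longrightarrow> f (u c) = scale c (u c)" "sum u S \<in> X" "c \<in> S"
  shows "u c \<in> X"
  using assms(4-)
proof (induction S arbitrary: u c rule: finite_induct)
  case empty
  then show ?case by simp
next
  case (insert \<mu> S)
  interpret f: Vector_Spaces.linear scale scale f by fact
  define s where "s = sum u (insert \<mu> S)"
  have "f s - scale \<mu> s \<in> X"
    using insert.prems(2) X by (auto simp: s_def intro!: subspace_diff subspace_scale)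
  also have "f s - scale \<mu> s = (\<Sum>c\<in>insert \<mu> S. scale (c - \<mu>) (u c))"
    unfolding s_def f.sum scale_sum_right sum_subtractf[symmetric]
    by (rule sum.cong) (auto simp: insert.prems(1) scale_left_diff_distrib)
  also have "\<dots> = (\<Sum>c\<in>S. scale (c - \<mu>) (u c))"
    using insert.hyps by simp
  finally have sum_mem: "(\<Sum>c\<in>S. scale (c - \<mu>) (u c)) \<in> X" .
  have mem: "u d \<in> X" if "d \<in> S" for d
  proof -
    have "scale (d - \<mu>) (u d) \<in> X"
    proof (rule insert.IH[OF _ sum_mem that])
      fix c assume "c \<in> S"
      then show "f (scale (c - \<mu>) (u c)) = scale c (scale (c - \<mu>) (u c))"
        by (simp add: f.scale insert.prems(1) mult.commute)
    qed
    then have "scale (inverse (d - \<mu>)) (scale (d - \<mu>) (u d)) \<in> X"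
      by (rule subspace_scale[OF X(1)])
    moreover have "d \<noteq> \<mu>"
      using that insert.hyps by auto
    ultimately show ?thesis
      by simp
  qed
  have "u \<mu> = s - sum u S"
    using insert.hyps by (simp add: s_def)
  then have "u \<mu> \<in> X"
    using mem insert.prems(2) X(1) by (auto simp: s_def intro!: subspace_diff subspace_sum)
  with mem insert.prems(3) show ?case by auto
qed

text \<open>Terms with the same eigenvalue are grouped together. Indexing the components by the
  eigenvalue itself makes distinct indices have distinct eigenvalues, as
  \<open>eigenvector_component_mem\<close> needs.\<close>

lemma span_eigenvectors_sum:
  assumes f: "Vector_Spaces.linear scale scale f" and v: "v \<in> span (eigenvectors f)"
  obtains S u where "finite S" "\<And>c. f (u c) = scale c (u c)" "v = sum u S"
proof -
  interpret f: Vector_Spaces.linear scale scale f by fact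
  \<comment> \<open>The vanishing of \<open>u\<close> outside \<open>S\<close> is carried along so
    that \<open>S\<close> can absorb a new eigenvalue without changing the sum.\<close>
  define P where "P v \<longleftrightarrow> (\<exists>S u. finite S \<and> (\<forall>c. f (u c) = scale c (u c)) \<and>
    (\<forall>c. c \<notin> S \<longrightarrow> u c = 0) \<and> v = sum u S)" for v
  have "P v"
    using v
  proof (induction rule: span_induct_alt)
    case base
    show ?case
      unfolding P_def by (rule exI[of _ "{}"], rule exI[of _ "\<lambda>_. 0"]) (simp add: f.zero)
  next
    case (step a x y)
    from step.hyps(1) obtain d where d: "f x = scale d x"
      by (auto simp: eigenvectors_def)
    from step.IH obtain S u where S: "finite S" and u: "\<forall>c. f (u c) = scale c (u c)"
      and u0: "\<forall>c. c \<notin> S \<longrightarrow> u c = 0" and y: "y = sum u S"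
      unfolding P_def by blast
    define u' where "u' = (\<lambda>c. u c + (if c = d then scale a x else 0))"
    have "sum u' (insert d S) = sum u (insert d S) + scale a x"
      using S by (simp add: u'_def sum.distrib)
    also have "sum u (insert d S) = y"
      using S u0 unfolding y by (intro sum.mono_neutral_right) auto
    finally have "scale a x + y = sum u' (insert d S)"
      by (simp add: add.commute)
    moreover have "\<forall>c. f (u' c) = scale c (u' c)"
      using u by (auto simp: u'_def f.add f.scale d scale_right_distrib mult.commute)
    moreover have "\<forall>c. c \<notin> insert d S \<longrightarrow> u' c = 0"
      using u0 by (auto simp: u'_def)
    ultimately show ?case
      unfolding P_def using S by blast
  qed
  then show thesis
    unfolding P_def using that by blast
qed

text \<open>The components of \<open>v\<close> for distinct eigenvalues already lie in
  \<open>X\<close>; thus diagonalizability passes to invariant subspaces.\<close>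

lemma mem_span_invariant_eigenvectors:
  assumes f: "Vector_Spaces.linear scale scale f" and X: "subspace X" "f ` X \<subseteq> X"
    and v: "v \<in> X" "v \<in> span (eigenvectors f)"
  shows "v \<in> span (X \<inter> eigenvectors f)"
proof -
  obtain S u where S: "finite S" and u: "\<And>c. f (u c) = scale c (u c)" and v_eq: "v = sum u S"
    using span_eigenvectors_sum[OF f v(2)] by blast
  have "u c \<in> X \<inter> eigenvectors f" if "c \<in> S" for c
    using eigenvector_component_mem[OF f X S u] v(1) that u by (auto simp: v_eq eigenvectors_def)
  then show ?thesis
    unfolding v_eq by (intro span_sum span_base)
qed

section \<open>Commuting families of diagonalizable maps\<close>

text \<open>Induction on \<open>F\<close>: a joint eigenspace \<open>X\<close> of the maps treated
  so far is stable under the next map \<open>T\<close>, which commutes with them, so each vector of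
  \<open>X\<close> is a sum of eigenvectors of \<open>T\<close> inside \<open>X\<close>.\<close>

lemma span_joint_eigenvectors:
  assumes "finite F"
    and "\<And>T. T \<in> F \<Longrightarrow> Vector_Spaces.linear scale scale T"
    and "\<And>T. T \<in> F \<Longrightarrow> span (eigenvectors T) = UNIV"
    and "\<And>S T. S \<in> F \<Longrightarrow> T \<in> F \<Longrightarrow> S \<circ> T = T \<circ> S"
  shows "span {v. \<forall>T\<in>F. v \<in> eigenvectors T} = UNIV"
  using assms
proof (induction F rule: finite_induct)
  case empty
  then show ?case by simp
next
  case (insert T F)
  have "{v. \<forall>S\<in>F. v \<in> eigenvectors S} \<subseteq> span {v. \<forall>S\<in>insert T F. v \<in> eigenvectors S}"
  proof
    fix u assume "u \<in> {v. \<forall>S\<in>F. v \<in> eigenvectors S}"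
    then obtain \<chi> where \<chi>: "\<And>S. S \<in> F \<Longrightarrow> S u = scale (\<chi> S) u"
      unfolding eigenvectors_def by simp metis
    define X where "X = {v. \<forall>S\<in>F. S v = scale (\<chi> S) v}"
    have T: "Vector_Spaces.linear scale scale T"
      using insert.prems by blast
    have zero: "S 0 = 0" if "S \<in> F" for S
    proof -
      interpret S: Vector_Spaces.linear scale scale S
        using insert.prems(1) that by blast
      show ?thesis by (rule S.zero)
    qed
    have "subspace X"
      using insert.prems(1)
      by (auto simp: X_def subspace_def zero Vector_Spaces.linear_iff scale_right_distrib
          scale_left_commute simp del: scale_scale)
    moreover have "T ` X \<subseteq> X"
    proof
      fix w assume "w \<in> T ` X"
      then obtain v where v: "v \<in> X" "w = T v" by auto
      have "S (T v) = scale (\<chi> S) (T v)" if "S \<in> F" for S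
      proof -
        have "S (T v) = T (S v)"
          using insert.prems(3)[of S T] that by (auto simp: fun_eq_iff)
        then show ?thesis
          using v(1) that T by (auto simp: X_def Vector_Spaces.linear_iff)
      qed
      then show "w \<in> X"
        using v by (simp add: X_def)
    qed
    moreover have "u \<in> X"
      using \<chi> by (simp add: X_def)
    moreover have "u \<in> span (eigenvectors T)"
      using insert.prems(2) by simp
    ultimately have "u \<in> span (X \<inter> eigenvectors T)"
      by (intro mem_span_invariant_eigenvectors[OF T])
    also have "\<dots> \<subseteq> span {v. \<forall>S\<in>insert T F. v \<in> eigenvectors S}"
      by (rule span_mono) (auto simp: X_def eigenvectors_def)
    finally show "u \<in> span {v. \<forall>S\<in>insert T F. v \<in> eigenvectors S}" .
  qed
  then have "span {v. \<forall>S\<in>F. v \<in> eigenvectors S} \<subseteq> span {v. \<forall>S\<in>insert T F. v \<in> eigenvectors S}"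
    by (rule span_minimal) simp
  with insert show ?case by auto
qed

text \<open>A basis \<open>A\<close> of \<open>W\<close> is completed to a basis of the space by
  joint eigenvectors only. The map \<open>p\<close> fixes \<open>A\<close> and kills the added
  vectors; since every \<open>T\<close> in \<open>F\<close> preserves \<open>W\<close> and rescales
  the added vectors, it commutes with \<open>p\<close>.\<close>

lemma exists_commuting_projection:
  assumes W: "subspace W"
    and J: "span {v. \<forall>T\<in>F. v \<in> eigenvectors T} = UNIV"
    and lin: "\<And>T. T \<in> F \<Longrightarrow> Vector_Spaces.linear scale scale T"
    and inv: "\<And>T. T \<in> F \<Longrightarrow> T ` W \<subseteq> W"
  obtains p where "Vector_Spaces.linear scale scale p" "range p \<subseteq> W"
    "\<And>w. w \<in> W \<Longrightarrow> p w = w" "\<And>T. T \<in> F \<Longrightarrow> T \<circ> p = p \<circ> T"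
proof -
  interpret vector_space_pair scale scale ..
  define J where "J = {v. \<forall>T\<in>F. v \<in> eigenvectors T}"
  obtain A where A: "A \<subseteq> W" "independent A" "W \<subseteq> span A"
    using maximal_independent_subset by blast
  obtain B where B: "A \<subseteq> B" "B \<subseteq> A \<union> J" "independent B" "A \<union> J \<subseteq> span B"
    using maximal_independent_subset_extend[of A "A \<union> J"] A(2) by blast
  have spanA: "span A = W"
    using A W by (intro span_subspace)
  have "span J \<subseteq> span B"
    using B(4) by (intro span_minimal) auto
  then have spanB: "span B = UNIV"
    using J by (auto simp: J_def)
  define p where "p = construct B (\<lambda>b. if b \<in> A then b else 0)"
  have p: "Vector_Spaces.linear scale scale p"
    unfolding p_def by (rule linear_construct[OF B(3)])
  interpret p: Vector_Spaces.linear scale scale p by fact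
  have p_basis: "p b = (if b \<in> A then b else 0)" if "b \<in> B" for b
    using that by (simp add: p_def construct_basis[OF B(3)])
  have p_id: "p w = w" if "w \<in> W" for w
    using linear_eq_on[OF p linear_ident, of w A] that p_basis B(1) spanA by (simp add: subset_iff)
  have range: "p v \<in> W" for v
  proof -
    have "v \<in> span B" using spanB by simp
    then show ?thesis
    proof (induction rule: span_induct_alt)
      case base
      then show ?case using W by (simp add: p.zero subspace_0)
    next
      case (step c x y)
      then show ?case
        using W A(1) p_basis[of x]
        by (auto simp: p.add p.scale intro!: subspace_add subspace_scale subspace_0)
    qed
  qed
  have comm: "T \<circ> p = p \<circ> T" if T: "T \<in> F" for T
  proof
    fix v
    interpret T: Vector_Spaces.linear scale scale T using lin[OF T] .
    show "(T \<circ> p) v = (p \<circ> T) v"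
    proof (rule linear_eq_on[where f = "T \<circ> p" and g = "p \<circ> T"])
      show "Vector_Spaces.linear scale scale (T \<circ> p)"
        using lin[OF T] p by (simp add: Vector_Spaces.linear_iff)
      show "Vector_Spaces.linear scale scale (p \<circ> T)"
        using lin[OF T] p by (simp add: Vector_Spaces.linear_iff)
      show "v \<in> span B" using spanB by simp
      fix b assume b: "b \<in> B"
      show "(T \<circ> p) b = (p \<circ> T) b"
      proof (cases "b \<in> A")
        case True
        then have "T b \<in> W" using inv[OF T] A(1) by auto
        then show ?thesis using p_basis[OF b] True p_id by simp
      next
        case False
        then obtain c where "T b = scale c b"
          using b B(2) T by (auto simp: J_def eigenvectors_def)
        then show ?thesis
          using p_basis[OF b] False by (simp add: p.scale T.zero)
      qed
    qed
  qed
  show thesis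
    by (rule that[OF p _ p_id comm]) (use range in auto)
qed

end

subsection \<open>Finite orbits\<close>

text \<open>The argument behind Dietzmann's lemma: occurrences of a letter can be collected
  at the front of a word without changing its length.\<close>
lemma collect_letter:
  fixes a :: "'i \<Rightarrow> 's \<Rightarrow> 's"
  assumes closed: "\<And>x s. x \<in> A \<Longrightarrow> s \<in> E \<Longrightarrow> a x s \<in> E"
    and swap: "\<And>x y. x \<in> A \<Longrightarrow> y \<in> A \<Longrightarrow> \<exists>z\<in>A. \<forall>s\<in>E. a y (a x s) = a x (a z s)"
    and x: "x \<in> A"
  shows "ws \<in> lists A \<Longrightarrow> k \<le> count_list ws x \<Longrightarrow>
    \<exists>vs\<in>lists A. length ws = length vs + k \<and> (\<forall>s\<in>E. foldr a ws s = (a x ^^ k) (foldr a vs s))"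
proof (induction ws arbitrary: k)
  case Nil
  then show ?case by auto
next
  case (Cons w ws)
  have foldr_mem: "foldr a vs s \<in> E" if "vs \<in> lists A" "s \<in> E" for vs s
    using that by (induction vs) (auto intro: closed)
  show ?case
  proof (cases "w = x")
    case True
    show ?thesis
    proof (cases k)
      case 0
      then show ?thesis using Cons.prems by (intro bexI[of _ "w # ws"]) auto
    next
      case (Suc j)
      then have "j \<le> count_list ws x" using Cons.prems True by simp
      then obtain vs where "vs \<in> lists A" "length ws = length vs + j"
          "\<forall>s\<in>E. foldr a ws s = (a x ^^ j) (foldr a vs s)"
        using Cons.IH[of j] Cons.prems by auto
      then show ?thesis using True Suc by (intro bexI[of _ vs]) auto
    qed
  next
    case False
    then have "k \<le> count_list ws x" using Cons.prems by simp
    then obtain vs where vs: "vs \<in> lists A" "length ws = length vs + k"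
        "\<forall>s\<in>E. foldr a ws s = (a x ^^ k) (foldr a vs s)"
      using Cons.IH[of k] Cons.prems by auto
    have "w \<in> A" using Cons.prems by simp
    \<comment> \<open>The letter \<open>w\<close> is moved past the \<open>k\<close> copies of
      \<open>x\<close> one at a time; each swap may turn it into another letter of
      \<open>A\<close>.\<close>
    then have "\<exists>z\<in>A. \<forall>s\<in>E. a w ((a x ^^ k) s) = (a x ^^ k) (a z s)"
    proof (induction k arbitrary: w)
      case 0
      then show ?case by auto
    next
      case (Suc k)
      obtain z where z: "z \<in> A" "\<forall>s\<in>E. a w (a x s) = a x (a z s)"
        using swap[OF x Suc.prems] by blast
      obtain z' where z': "z' \<in> A" "\<forall>s\<in>E. a z ((a x ^^ k) s) = (a x ^^ k) (a z' s)"
        using Suc.IH[OF z(1)] by blast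
      have "(a x ^^ k) s \<in> E" if "s \<in> E" for s
        using that x by (induction k) (auto intro: closed)
      then show ?case using z z' by (intro bexI[of _ z']) auto
    qed
    then obtain z where "z \<in> A" "\<forall>s\<in>E. a w ((a x ^^ k) s) = (a x ^^ k) (a z s)"
      by blast
    then show ?thesis
      using vs foldr_mem by (intro bexI[of _ "z # vs"]) auto
  qed
qed

text \<open>A word longer than \<open>card A * N\<close> contains some letter at least
  \<open>N\<close> times, by the pigeonhole principle. Collecting \<open>N\<close> of these at the
  front and cancelling them leaves a shorter word with the same effect on \<open>s\<close>, so words
  of bounded length reach the whole orbit.\<close>

lemma finite_orbit:
  fixes a :: "'i \<Rightarrow> 's \<Rightarrow> 's"
  assumes A: "finite A"
    and closed: "\<And>x s. x \<in> A \<Longrightarrow> s \<in> E \<Longrightarrow> a x s \<in> E"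
    and swap: "\<And>x y. x \<in> A \<Longrightarrow> y \<in> A \<Longrightarrow> \<exists>z\<in>A. \<forall>s\<in>E. a y (a x s) = a x (a z s)"
    and order: "\<And>x s. x \<in> A \<Longrightarrow> s \<in> E \<Longrightarrow> (a x ^^ N) s = s"
    and N: "N > 0" and s: "s \<in> E"
  shows "finite ((\<lambda>ws. foldr a ws s) ` lists A)"
proof -
  define L where "L = {ws. set ws \<subseteq> A \<and> length ws \<le> card A * N}"
  have "\<exists>vs\<in>L. foldr a ws s = foldr a vs s" if "ws \<in> lists A" for ws
    using that
  proof (induction ws rule: length_induct)
    case (1 ws)
    show ?case
    proof (cases "length ws \<le> card A * N")
      case True
      then show ?thesis using 1 by (intro bexI[of _ ws]) (auto simp: L_def)
    next
      case False
      have "\<exists>x\<in>A. N \<le> count_list ws x"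
      proof (rule ccontr)
        assume "\<not> ?thesis"
        then have "sum (count_list ws) A \<le> card A * N"
          using sum_bounded_above[of A "count_list ws" N] by (simp add: not_le less_imp_le)
        then show False
          using False sum_count_set[of ws A] A 1 by auto
      qed
      then obtain x where x: "x \<in> A" "N \<le> count_list ws x" by blast
      obtain vs where vs: "vs \<in> lists A" "length ws = length vs + N"
          "\<forall>s\<in>E. foldr a ws s = (a x ^^ N) (foldr a vs s)"
        using collect_letter[of A E a, OF closed swap x(1) _ x(2)] 1 by blast
      have "foldr a vs s \<in> E"
        using vs(1) s by (induction vs) (auto intro: closed)
      then have "foldr a ws s = foldr a vs s"
        using vs(3) s order x(1) by simp
      moreover have "\<exists>us\<in>L. foldr a vs s = foldr a us s"
        using 1 vs N by simp
      ultimately show ?thesis by simp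
    qed
  qed
  then have "(\<lambda>ws. foldr a ws s) ` lists A \<subseteq> (\<lambda>ws. foldr a ws s) ` L"
    by auto
  moreover have "finite L"
    unfolding L_def by (rule finite_lists_length_le[OF A])
  ultimately show ?thesis
    by (meson finite_surj)
qed

subsection \<open>Invariant complements\<close>

lemma funpow_comp_commute:
  fixes f g :: "'a \<Rightarrow> 'a"
  assumes "f \<circ> g = g \<circ> f"
  shows "(f ^^ n) \<circ> g = g \<circ> (f ^^ n)"
  using assms by (induction n) (auto simp: fun_eq_iff)

context quandle_representation
begin

lemma rep_linear: "x \<in> Q \<Longrightarrow> Vector_Spaces.linear scale scale (\<rho> x)"
  and rep_bij: "x \<in> Q \<Longrightarrow> bij (\<rho> x)"
  using rep_GL by (auto simp: general_linear_def)

text \<open>Clearing the inverse turns the conjugation relation into a rule for moving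
  \<open>\<rho> x\<close> across other representing maps.\<close>

lemma rep_comp:
  assumes "x \<in> Q" "y \<in> Q"
  shows "\<rho> (x \<rhd> y) \<circ> \<rho> x = \<rho> x \<circ> \<rho> y"
  using rep_conj[OF assms] bij_is_inj[OF rep_bij[OF assms(1)]] by (auto simp: fun_eq_iff)

text \<open>Iterating left translation by \<open>x\<close> on the quandle corresponds to conjugating
  by powers of \<open>\<rho> x\<close>.\<close>

lemma rep_funpow_comp:
  assumes "x \<in> Q" "y \<in> Q"
  shows "((\<rhd>) x ^^ n) y \<in> Q \<and> \<rho> (((\<rhd>) x ^^ n) y) \<circ> (\<rho> x ^^ n) = (\<rho> x ^^ n) \<circ> \<rho> y"
proof (induction n)
  case 0
  then show ?case using assms by simp
next
  case (Suc n)
  then show ?case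
    using rep_comp[of x "((\<rhd>) x ^^ n) y"] assms closed by (auto simp: fun_eq_iff)
qed

end

section \<open>Central powers of the representing maps\<close>

text \<open>Characteristic zero permits division by the number of conjugates when averaging.\<close>

locale finite_quandle_representation = quandle_representation Q qop scale \<rho>
  for Q :: "'q set" and qop :: "'q \<Rightarrow> 'q \<Rightarrow> 'q" (infixl "\<rhd>" 70)
    and scale :: "'k::field_char_0 \<Rightarrow> 'v::ab_group_add \<Rightarrow> 'v"
    and \<rho> :: "'q \<Rightarrow> 'v \<Rightarrow> 'v" +
  assumes finite_Q: "finite Q"
begin

text \<open>The iterates of left translation by \<open>x\<close> on \<open>y\<close> stay in the
  finite set \<open>Q\<close>, so two of them coincide. The exponent \<open>n\<close> is the
  difference of their indices.\<close>

lemma exists_commuting_power: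
  assumes x: "x \<in> Q" and y: "y \<in> Q"
  shows "\<exists>n>0. (\<rho> x ^^ n) \<circ> \<rho> y = \<rho> y \<circ> (\<rho> x ^^ n)"
proof -
  have "range (\<lambda>n. ((\<rhd>) x ^^ n) y) \<subseteq> Q"
    using rep_funpow_comp[OF x y] by auto
  then have "\<not> inj (\<lambda>n. ((\<rhd>) x ^^ n) y)"
    using finite_Q finite_subset range_inj_infinite by blast
  then obtain i j where "i < j" and eq: "((\<rhd>) x ^^ i) y = ((\<rhd>) x ^^ j) y"
    unfolding inj_def by (metis linorder_neqE_nat)
  then obtain n where n: "j = i + n" "n > 0"
    using less_imp_add_positive by blast
  have inj: "inj (\<rho> x ^^ i)"
    using bij_is_inj[OF rep_bij[OF x]] by (rule inj_fn)
  \<comment> \<open>Both iterates equal \<open>z\<close>, so \<open>\<rho> z\<close> is the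
    conjugate of \<open>\<rho> y\<close> by \<open>\<rho> x ^^ i\<close> and by
    \<open>\<rho> x ^^ j\<close>; cancelling \<open>\<rho> x ^^ i\<close> leaves commutation with
    \<open>\<rho> x ^^ n\<close>.\<close>
  define z where "z = ((\<rhd>) x ^^ i) y"
  have z_i: "\<rho> z ((\<rho> x ^^ i) v) = (\<rho> x ^^ i) (\<rho> y v)" for v
    using rep_funpow_comp[OF x y, of i] by (simp add: z_def fun_eq_iff)
  have z_j: "\<rho> z ((\<rho> x ^^ i) ((\<rho> x ^^ n) v)) = (\<rho> x ^^ i) ((\<rho> x ^^ n) (\<rho> y v))" for v
    using rep_funpow_comp[OF x y, of j] eq n(1) by (simp add: z_def fun_eq_iff funpow_add)
  have "(\<rho> x ^^ i) ((\<rho> x ^^ n) (\<rho> y v)) = (\<rho> x ^^ i) (\<rho> y ((\<rho> x ^^ n) v))" for v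
    using z_i z_j by simp
  then show ?thesis
    using n(2) inj by (intro exI[of _ n]) (auto simp: fun_eq_iff inj_def)
qed

lemma exists_central_exponent:
  obtains N where "N > 0"
    "\<And>x y. x \<in> Q \<Longrightarrow> y \<in> Q \<Longrightarrow> (\<rho> x ^^ N) \<circ> \<rho> y = \<rho> y \<circ> (\<rho> x ^^ N)"
proof -
  define n where "n x y = (SOME n. n > 0 \<and> (\<rho> x ^^ n) \<circ> \<rho> y = \<rho> y \<circ> (\<rho> x ^^ n))" for x y
  have n: "n x y > 0 \<and> (\<rho> x ^^ n x y) \<circ> \<rho> y = \<rho> y \<circ> (\<rho> x ^^ n x y)" if "x \<in> Q" "y \<in> Q" for x y
    unfolding n_def by (rule someI_ex) (use exists_commuting_power that in blast)
  \<comment> \<open>Any positive common multiple of the pairwise exponents would do; the product is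
    one.\<close>
  define N where "N = (\<Prod>(x, y)\<in>Q \<times> Q. n x y)"
  show thesis
  proof (rule that)
    show "N > 0"
      unfolding N_def using n by (intro prod_pos) auto
    fix x y assume xy: "x \<in> Q" "y \<in> Q"
    have "n x y dvd N"
      unfolding N_def using dvd_prodI[of "Q \<times> Q" "(x, y)" "\<lambda>(x, y). n x y"] finite_Q xy by simp
    then obtain m where "N = n x y * m" by blast
    then show "(\<rho> x ^^ N) \<circ> \<rho> y = \<rho> y \<circ> (\<rho> x ^^ N)"
      using funpow_comp_commute[of "\<rho> x ^^ n x y" "\<rho> y" m] n[OF xy] by (simp add: funpow_mult mult.commute)
  qed
qed

section \<open>Averaging a projection\<close>

text \<open>\<open>W\<close> is spanned by eigenvectors, and one with eigenvalue
  \<open>c \<noteq> 0\<close> is the image of its multiple by \<open>inverse c\<close>. Equality,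
  rather than mere inclusion, makes \<open>inv (\<rho> x)\<close> preserve \<open>W\<close> as well,
  so that conjugates of projections onto \<open>W\<close> still fix \<open>W\<close>
  pointwise.\<close>

lemma rep_image_subrepresentation:
  assumes W: "subrepresentation W" and x: "x \<in> Q" and diag: "span (eigenvectors (\<rho> x)) = UNIV"
  shows "\<rho> x ` W = W"
proof
  interpret f: Vector_Spaces.linear scale scale "\<rho> x" using rep_linear[OF x] .
  have subW: "subspace W" and WW: "\<rho> x ` W \<subseteq> W"
    using W x by (auto simp: subrepresentation_def)
  show "\<rho> x ` W \<subseteq> W" by fact
  have "W \<inter> eigenvectors (\<rho> x) \<subseteq> \<rho> x ` W"
  proof
    fix w assume "w \<in> W \<inter> eigenvectors (\<rho> x)"
    then obtain c where w: "w \<in> W" "\<rho> x w = scale c w"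
      by (auto simp: eigenvectors_def)
    show "w \<in> \<rho> x ` W"
    proof (cases "c = 0")
      case True
      then have "\<rho> x w = \<rho> x 0" using w f.zero by simp
      then have "w = 0" using bij_is_inj[OF rep_bij[OF x]] by (simp add: inj_def)
      then show ?thesis using f.zero subspace_0[OF subW] by (metis imageI)
    next
      case False
      then have "\<rho> x (scale (inverse c) w) = w" using w by (simp add: f.scale)
      then show ?thesis using w subspace_scale[OF subW] by (metis imageI)
    qed
  qed
  then have "span (W \<inter> eigenvectors (\<rho> x)) \<subseteq> \<rho> x ` W"
    by (rule span_minimal) (rule f.subspace_image[OF subW])
  then show "W \<subseteq> \<rho> x ` W"
    using mem_span_invariant_eigenvectors[OF rep_linear[OF x] subW WW] diag by auto
qed

text \<open>As in Maschke's theorem, but averaging over the conjugates of a projection that commutes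
  with the central powers \<open>\<rho> x ^^ N\<close>: these are finitely many although the group generated by
  \<open>\<rho> ` Q\<close> may be infinite.\<close>
lemma exists_complement:
  assumes diag: "\<And>x. x \<in> Q \<Longrightarrow> span (eigenvectors (\<rho> x)) = UNIV" and W: "subrepresentation W"
  obtains U where "subrepresentation U" "W \<inter> U = {0}" "\<And>v. \<exists>w\<in>W. \<exists>u\<in>U. v = w + u"
proof -
  obtain N where N: "N > 0"
    and central: "\<And>x y. x \<in> Q \<Longrightarrow> y \<in> Q \<Longrightarrow> (\<rho> x ^^ N) \<circ> \<rho> y = \<rho> y \<circ> (\<rho> x ^^ N)"
    using exists_central_exponent by blast
  have subW: "subspace W" and WW: "\<And>x. x \<in> Q \<Longrightarrow> \<rho> x ` W \<subseteq> W"
    using W by (auto simp: subrepresentation_def)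
  have power_inv: "(\<rho> x ^^ n) ` W \<subseteq> W" if "x \<in> Q" for x n
    using WW[OF that] by (induction n) (auto simp: image_subset_iff)
  define F where "F = (\<lambda>x. \<rho> x ^^ N) ` Q"
  have F_lin: "Vector_Spaces.linear scale scale T" if "T \<in> F" for T
    using that by (auto simp: F_def intro: linear_funpow rep_linear)
  have F_diag: "span (eigenvectors T) = UNIV" if "T \<in> F" for T
    using that span_mono[OF eigenvectors_funpow[OF rep_linear]] diag by (auto simp: F_def)
  have F_comm: "S \<circ> T = T \<circ> S" if "S \<in> F" "T \<in> F" for S T
  proof -
    obtain x y where "x \<in> Q" "S = \<rho> x ^^ N" "y \<in> Q" "T = \<rho> y ^^ N"
      using \<open>S \<in> F\<close> \<open>T \<in> F\<close> by (auto simp: F_def)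
    then show ?thesis
      using funpow_comp_commute[OF central[symmetric], of y x N] by simp
  qed
  have joint: "span {v. \<forall>T\<in>F. v \<in> eigenvectors T} = UNIV"
    using finite_Q F_lin F_diag F_comm by (intro span_joint_eigenvectors) (auto simp: F_def)
  obtain p where p: "Vector_Spaces.linear scale scale p" "range p \<subseteq> W"
      "\<And>w. w \<in> W \<Longrightarrow> p w = w" "\<And>T. T \<in> F \<Longrightarrow> T \<circ> p = p \<circ> T"
    using exists_commuting_projection[OF subW joint F_lin] power_inv unfolding F_def by blast
  define a where "a x q = \<rho> x \<circ> q \<circ> inv (\<rho> x)" for x and q :: "'v \<Rightarrow> 'v"
  \<comment> \<open>The action \<open>a x\<close> is conjugation by \<open>\<rho> x\<close>. It is
    considered on the commutant \<open>E\<close> of the central powers, where its order divides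
    \<open>N\<close>.\<close>
  define E where "E = {q. \<forall>T\<in>F. T \<circ> q = q \<circ> T}"
  \<comment> \<open>Only words in the \<open>a x\<close> themselves are used; inverses come for free
    once the orbit is known to be finite.\<close>
  define Orb where "Orb = (\<lambda>ws. foldr a ws p) ` lists Q"
  define Proj where
    "Proj = {q. Vector_Spaces.linear scale scale q \<and> range q \<subseteq> W \<and> (\<forall>w\<in>W. q w = w)}"
  have inv1: "inv (\<rho> x) (\<rho> x v) = v" and inv2: "\<rho> x (inv (\<rho> x) v) = v" if "x \<in> Q" for x v
    using rep_bij[OF that] by (auto simp: bij_is_inj surj_f_inv_f bij_is_surj)
  have "finite Orb"
    unfolding Orb_def
  proof (rule finite_orbit[OF finite_Q, where E = E])
    fix x q assume x: "x \<in> Q" and q: "q \<in> E"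
    show "a x q \<in> E"
      unfolding E_def
    proof (intro CollectI ballI ext)
      fix T v assume T: "T \<in> F"
      have Tx: "T (\<rho> x w) = \<rho> x (T w)" for w
        using T central[OF _ x] by (auto simp: F_def fun_eq_iff)
      have "T (inv (\<rho> x) v) = inv (\<rho> x) (T v)"
        using Tx[of "inv (\<rho> x) v"] inv1[OF x] inv2[OF x] by metis
      moreover have "T (q w) = q (T w)" for w
        using q T by (auto simp: E_def fun_eq_iff)
      ultimately show "(T \<circ> a x q) v = (a x q \<circ> T) v"
        using Tx by (simp add: a_def)
    qed
    \<comment> \<open>The \<open>N\<close>-fold action is conjugation by
      \<open>\<rho> x ^^ N\<close>, which commutes with every \<open>q\<close> in
      \<open>E\<close>.\<close>
    have "(a x ^^ n) q = (\<rho> x ^^ n) \<circ> q \<circ> (inv (\<rho> x) ^^ n)" for n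
      by (induction n) (simp_all add: a_def fun_eq_iff funpow_swap1)
    also have "(\<rho> x ^^ N) \<circ> q = q \<circ> (\<rho> x ^^ N)"
      using q x by (auto simp: E_def F_def)
    also have "q \<circ> (\<rho> x ^^ N) \<circ> (inv (\<rho> x) ^^ N) = q"
      using fn_o_inv_fn_is_id[OF rep_bij[OF x]] by (simp add: fun_eq_iff)
    finally show "(a x ^^ N) q = q" .
  next
    fix x y assume x: "x \<in> Q" and y: "y \<in> Q"
    \<comment> \<open>Writing \<open>y\<close> as \<open>x \<rhd> z\<close> turns
      \<open>\<rho> y \<circ> \<rho> x\<close> into \<open>\<rho> x \<circ> \<rho> z\<close>, which
      is the swap rule for words.\<close>
    obtain z where z: "z \<in> Q" "x \<rhd> z = y"
      using left_div[OF x y] by blast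
    have comm: "\<rho> y \<circ> \<rho> x = \<rho> x \<circ> \<rho> z"
      using rep_comp[OF x z(1)] z(2) by simp
    have inv_comm: "inv (\<rho> x) \<circ> inv (\<rho> y) = inv (\<rho> z) \<circ> inv (\<rho> x)"
      using arg_cong[OF comm, of inv] rep_bij x y z(1) by (simp add: o_inv_distrib)
    have "a y (a x q) = a x (a z q)" for q
    proof -
      have "a y (a x q) = (\<rho> y \<circ> \<rho> x) \<circ> q \<circ> (inv (\<rho> x) \<circ> inv (\<rho> y))"
        by (simp add: a_def comp_assoc)
      also have "\<dots> = a x (a z q)"
        unfolding comm inv_comm by (simp add: a_def comp_assoc)
      finally show ?thesis .
    qed
    then show "\<exists>z\<in>Q. \<forall>q\<in>E. a y (a x q) = a x (a z q)"
      using z(1) by blast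
  next
    show "p \<in> E" using p(4) by (simp add: E_def)
  qed (fact N)
  have a_Proj: "a x q \<in> Proj" if x: "x \<in> Q" and q: "q \<in> Proj" for x q
  proof -
    interpret f: Vector_Spaces.linear scale scale "\<rho> x" using rep_linear[OF x] .
    have inv_W: "inv (\<rho> x) w \<in> W" if "w \<in> W" for w
      using that rep_image_subrepresentation[OF W x diag[OF x]] inv1[OF x] by (metis imageE)
    have inv_add: "inv (\<rho> x) (u + v) = inv (\<rho> x) u + inv (\<rho> x) v" for u v
      using f.add inv1[OF x] inv2[OF x] by metis
    have inv_scale: "inv (\<rho> x) (scale c v) = scale c (inv (\<rho> x) v)" for c v
      using f.scale inv1[OF x] inv2[OF x] by metis
    have "Vector_Spaces.linear scale scale (a x q)"
      using q by (simp add: Proj_def Vector_Spaces.linear_iff a_def inv_add inv_scale f.add f.scale)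
    moreover have "range (a x q) \<subseteq> W"
      using q WW[OF x] by (simp add: Proj_def a_def image_subset_iff)
    ultimately show ?thesis
      using q inv_W inv2[OF x] by (simp add: Proj_def a_def)
  qed
  have Orb_Proj: "q \<in> Proj" if "q \<in> Orb" for q
  proof -
    have "foldr a ws p \<in> Proj" if "ws \<in> lists Q" for ws
      using that by (induction ws) (use p a_Proj in \<open>auto simp: Proj_def\<close>)
    with that show ?thesis by (auto simp: Orb_def)
  qed
  \<comment> \<open>An injective self-map of a finite set is onto, so each \<open>a x\<close>
    permutes the orbit.\<close>
  have a_Orb: "a x ` Orb = Orb" if x: "x \<in> Q" for x
  proof (rule endo_inj_surj[OF \<open>finite Orb\<close>])
    show "a x ` Orb \<subseteq> Orb"
    proof
      fix q assume "q \<in> a x ` Orb"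
      then obtain ws where "ws \<in> lists Q" "q = foldr a (x # ws) p"
        by (auto simp: Orb_def)
      then show "q \<in> Orb"
        unfolding Orb_def using x by (intro image_eqI[of _ _ "x # ws"]) auto
    qed
    show "inj_on (a x) Orb"
    proof (rule inj_onI, rule ext)
      fix q q' v assume "a x q = a x q'"
      then have "a x q (\<rho> x v) = a x q' (\<rho> x v)" by simp
      then show "q v = q' v"
        using inv1[OF x] by (simp add: a_def) metis
    qed
  qed
  \<comment> \<open>The average of the orbit. As an average of projections onto \<open>W\<close> it
    is again one, and since each \<open>a x\<close> permutes the orbit it commutes with every
    \<open>\<rho> x\<close>.\<close>
  define r where "r v = scale (inverse (of_nat (card Orb))) (\<Sum>q\<in>Orb. q v)" for v
  have "p \<in> Orb"
    unfolding Orb_def by (rule image_eqI[of _ _ "[]"]) auto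
  then have card_Orb: "of_nat (card Orb) \<noteq> (0 :: 'k)"
    using \<open>finite Orb\<close> by auto
  have r_lin: "Vector_Spaces.linear scale scale r"
  proof -
    have q: "Vector_Spaces.linear scale scale q" if "q \<in> Orb" for q
      using Orb_Proj[OF that] by (simp add: Proj_def)
    have "(\<Sum>q\<in>Orb. q (u + v)) = (\<Sum>q\<in>Orb. q u + q v)" for u v
      using q by (intro sum.cong) (auto simp: Vector_Spaces.linear_iff)
    moreover have "(\<Sum>q\<in>Orb. q (scale c v)) = (\<Sum>q\<in>Orb. scale c (q v))" for c v
      using q by (intro sum.cong) (auto simp: Vector_Spaces.linear_iff)
    ultimately show ?thesis
      by (simp add: Vector_Spaces.linear_iff r_def vector_space_axioms sum.distrib
          scale_right_distrib mult.commute flip: scale_sum_right)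
  qed
  interpret r: Vector_Spaces.linear scale scale r by (fact r_lin)
  have r_W: "r v \<in> W" for v
    unfolding r_def using Orb_Proj subW
    by (intro subspace_scale subspace_sum) (auto simp: Proj_def)
  have r_id: "r w = w" if "w \<in> W" for w
  proof -
    have "(\<Sum>q\<in>Orb. q w) = (\<Sum>q\<in>Orb. w)"
      using Orb_Proj that by (intro sum.cong) (auto simp: Proj_def)
    then show ?thesis using card_Orb by (simp add: r_def sum_constant_scale)
  qed
  have r_equivariant: "\<rho> x (r v) = r (\<rho> x v)" if x: "x \<in> Q" for x v
  proof -
    interpret f: Vector_Spaces.linear scale scale "\<rho> x" using rep_linear[OF x] .
    have inj: "inj_on (a x) Orb"
      using a_Orb[OF x] \<open>finite Orb\<close> by (simp add: finite_surj_inj)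
    have "(\<Sum>q\<in>Orb. q (\<rho> x v)) = (\<Sum>q\<in>a x ` Orb. q (\<rho> x v))"
      using a_Orb[OF x] by simp
    also have "\<dots> = (\<Sum>q\<in>Orb. \<rho> x (q v))"
      unfolding sum.reindex[OF inj] using inv1[OF x] by (simp add: a_def)
    finally show ?thesis by (simp add: r_def f.scale f.sum)
  qed
  show thesis
  proof (rule that)
    show "subrepresentation {v. r v = 0}"
      unfolding subrepresentation_def
    proof (intro conjI ballI)
      show "subspace {v. r v = 0}" by (rule r.subspace_kernel)
      fix f assume "f \<in> \<rho> ` Q"
      then obtain x where x: "x \<in> Q" "f = \<rho> x" by blast
      interpret f: Vector_Spaces.linear scale scale "\<rho> x" using rep_linear[OF x(1)] .
      show "f ` {v. r v = 0} \<subseteq> {v. r v = 0}"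
        using r_equivariant[OF x(1), symmetric] x(2) f.zero by auto
    qed
    show "W \<inter> {v. r v = 0} = {0}"
      using r_id subspace_0[OF subW] r.zero by auto
    show "\<exists>w\<in>W. \<exists>u\<in>{v. r v = 0}. v = w + u" for v
      using r_W r_id by (intro bexI[of _ "r v"] bexI[of _ "v - r v"]) (auto simp: r.diff)
  qed
qed

end

subsection \<open>Decomposition into irreducible subrepresentations\<close>

context vector_space
begin

text \<open>Meant for finite families: a \<open>sum\<close> over an infinite set is 0 by
  convention.\<close>

definition independent_subspaces :: "'b set set \<Rightarrow> bool" where
  "independent_subspaces \<W> \<longleftrightarrow>
    (\<forall>w. (\<forall>U\<in>\<W>. w U \<in> U) \<and> sum w \<W> = 0 \<longrightarrow> (\<forall>U\<in>\<W>. w U = 0))"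

end

context vector_space
begin

lemma span_Union_sum:
  assumes fin: "finite \<W>" and sub: "\<And>U. U \<in> \<W> \<Longrightarrow> subspace U" and v: "v \<in> span (\<Union>\<W>)"
  obtains w where "\<And>U. U \<in> \<W> \<Longrightarrow> w U \<in> U" "v = sum w \<W>"
proof -
  have "\<exists>w. (\<forall>U\<in>\<W>. w U \<in> U) \<and> v = sum w \<W>"
    using v
  proof (induction rule: span_induct_alt)
    case base
    show ?case by (rule exI[of _ "\<lambda>_. 0"]) (simp add: sub subspace_0)
  next
    case (step c x y)
    then obtain U w where U: "U \<in> \<W>" "x \<in> U" and w: "\<forall>U\<in>\<W>. w U \<in> U" "y = sum w \<W>"
      by blast
    define w' where "w' V = w V + (if V = U then scale c x else 0)" for V
    have "sum w' \<W> = y + scale c x"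
      using fin U w by (simp add: w'_def sum.distrib)
    moreover have "\<forall>V\<in>\<W>. w' V \<in> V"
      using w U sub by (auto simp: w'_def intro: subspace_add subspace_scale)
    ultimately show ?case by (metis add.commute)
  qed
  then show thesis using that by blast
qed

lemma direct_sum_decompositionI:
  assumes fin: "finite \<W>" and sub: "\<And>U. U \<in> \<W> \<Longrightarrow> subspace U"
    and indep: "independent_subspaces \<W>" and span: "span (\<Union>\<W>) = UNIV"
  shows "direct_sum_decomposition \<W>"
  unfolding direct_sum_decomposition_def
proof (intro conjI ballI allI ex_ex1I)
  show "subspace U" if "U \<in> \<W>" for U using sub that .
next
  fix v
  have sum_eq: "(\<Sum>U | w U \<noteq> 0. w U) = sum w \<W>" if "\<forall>U. U \<notin> \<W> \<longrightarrow> w U = 0" for w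
    using that by (intro sum.mono_neutral_left fin) auto
  obtain w where w: "\<And>U. U \<in> \<W> \<Longrightarrow> w U \<in> U" "v = sum w \<W>"
    using span_Union_sum[OF fin sub, of v] span by auto
  \<comment> \<open>\<open>direct_sum_decomposition\<close> requires components to vanish outside
    the family, so \<open>w\<close> is set to 0 there.\<close>
  define w' where "w' U = (if U \<in> \<W> then w U else 0)" for U
  have "v = sum w' \<W>"
    using w(2) by (auto simp: w'_def intro: sum.cong)
  moreover have "finite {U. w' U \<noteq> 0}"
    by (rule finite_subset[OF _ fin]) (auto simp: w'_def)
  ultimately have "(\<forall>U\<in>\<W>. w' U \<in> U) \<and> (\<forall>U. U \<notin> \<W> \<longrightarrow> w' U = 0) \<and>
      finite {U. w' U \<noteq> 0} \<and> v = (\<Sum>U | w' U \<noteq> 0. w' U)"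
    using w(1) sum_eq[of w'] by (simp add: w'_def)
  then show "\<exists>w. (\<forall>U\<in>\<W>. w U \<in> U) \<and> (\<forall>U. U \<notin> \<W> \<longrightarrow> w U = 0) \<and>
      finite {U. w U \<noteq> 0} \<and> v = (\<Sum>U | w U \<noteq> 0. w U)" by blast
  fix w1 w2
  assume 1: "(\<forall>U\<in>\<W>. w1 U \<in> U) \<and> (\<forall>U. U \<notin> \<W> \<longrightarrow> w1 U = 0) \<and>
      finite {U. w1 U \<noteq> 0} \<and> v = (\<Sum>U | w1 U \<noteq> 0. w1 U)"
    and 2: "(\<forall>U\<in>\<W>. w2 U \<in> U) \<and> (\<forall>U. U \<notin> \<W> \<longrightarrow> w2 U = 0) \<and>
      finite {U. w2 U \<noteq> 0} \<and> v = (\<Sum>U | w2 U \<noteq> 0. w2 U)"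
  have "sum (\<lambda>U. w1 U - w2 U) \<W> = 0"
    using 1 2 sum_eq[of w1] sum_eq[of w2] by (simp add: sum_subtractf)
  moreover have "\<forall>U\<in>\<W>. w1 U - w2 U \<in> U"
    using 1 2 sub by (auto intro: subspace_diff)
  ultimately have "\<forall>U\<in>\<W>. w1 U - w2 U = 0"
    using indep[unfolded independent_subspaces_def, rule_format, of "\<lambda>U. w1 U - w2 U"] by blast
  then show "w1 = w2"
    using 1 2 by (auto simp: fun_eq_iff)
qed

lemma direct_sum_decomposition_span:
  assumes "direct_sum_decomposition \<W>"
  shows "span (\<Union>\<W>) = UNIV"
proof -
  have "v \<in> span (\<Union>\<W>)" for v
  proof -
    obtain w where w: "\<forall>U\<in>\<W>. w U \<in> U" "\<forall>U. U \<notin> \<W> \<longrightarrow> w U = 0" "v = (\<Sum>U | w U \<noteq> 0. w U)"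
      using assms unfolding direct_sum_decomposition_def by metis
    show ?thesis
      unfolding w(3) using w(1,2) by (intro span_sum span_base) blast
  qed
  then show ?thesis by auto
qed

end

section \<open>Splitting off irreducible summands in finite dimension\<close>

locale finite_dimensional_finite_quandle_representation =
  finite_quandle_representation Q qop scale \<rho> + finite_dimensional_vector_space scale Basis
  for Q :: "'q set" and qop :: "'q \<Rightarrow> 'q \<Rightarrow> 'q" (infixl "\<rhd>" 70)
    and scale :: "'k::field_char_0 \<Rightarrow> 'v::ab_group_add \<Rightarrow> 'v"
    and \<rho> :: "'q \<Rightarrow> 'v \<Rightarrow> 'v" and Basis :: "'v set"
begin

text \<open>A nonzero subrepresentation of least dimension inside \<open>C\<close> is
  irreducible.\<close>

lemma exists_irreducible_subrepresentation:
  assumes "subrepresentation C" "C \<noteq> {0}"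
  obtains I where "irreducible_subrepresentation I" "I \<subseteq> C" "I \<noteq> {0}"
proof -
  obtain I where I: "subrepresentation I \<and> I \<subseteq> C \<and> I \<noteq> {0}"
    and min: "\<And>U. subrepresentation U \<and> U \<subseteq> C \<and> U \<noteq> {0} \<Longrightarrow> dim I \<le> dim U"
    using ex_has_least_nat[of "\<lambda>U. subrepresentation U \<and> U \<subseteq> C \<and> U \<noteq> {0}" C dim] assms by blast
  have "U = I" if "subrepresentation U" "U \<subseteq> I" "U \<noteq> {0}" for U
  proof (rule subspace_dim_equal)
    show "dim I \<le> dim U" using that I by (intro min) blast
  qed (use that I in \<open>simp_all add: subrepresentation_def\<close>)
  with I that show thesis by (auto simp: irreducible_subrepresentation_def)
qed

lemma subrepresentation_span_Union:
  assumes "\<And>U. U \<in> \<W> \<Longrightarrow> subrepresentation U"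
  shows "subrepresentation (span (\<Union>\<W>))"
  unfolding subrepresentation_def
proof (intro conjI ballI)
  fix f assume "f \<in> \<rho> ` Q"
  then obtain x where x: "x \<in> Q" "f = \<rho> x" by blast
  interpret f: Vector_Spaces.linear scale scale f using rep_linear x by simp
  have "f ` \<Union>\<W> \<subseteq> \<Union>\<W>"
    using assms x by (fastforce simp: subrepresentation_def)
  then show "f ` span (\<Union>\<W>) \<subseteq> span (\<Union>\<W>)"
    unfolding f.span_image[symmetric] by (rule span_mono)
qed simp

text \<open>Irreducible subrepresentations are added one by one, each inside an invariant complement
  of the span reached so far, until the dimension is exhausted.\<close>

lemma completely_reducible_if_diagonalizable:
  assumes diag: "\<And>x. x \<in> Q \<Longrightarrow> diagonalizable (\<rho> x)"
  shows completely_reducible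
proof -
  \<comment> \<open>The induction is on a lower bound \<open>k\<close> for the dimension of the
    span; taking \<open>k\<close> to be the full dimension gives the decomposition.\<close>
  have "\<exists>\<W>. finite \<W> \<and> (\<forall>W\<in>\<W>. irreducible_subrepresentation W) \<and> independent_subspaces \<W> \<and>
      k \<le> dim (span (\<Union>\<W>))" if "k \<le> dim (UNIV :: 'v set)" for k
    using that
  proof (induction k)
    case 0
    show ?case by (rule exI[of _ "{}"]) (simp add: independent_subspaces_def)
  next
    case (Suc k)
    then obtain \<W> where \<W>: "finite \<W>" "\<And>W. W \<in> \<W> \<Longrightarrow> irreducible_subrepresentation W"
        "independent_subspaces \<W>" "k \<le> dim (span (\<Union>\<W>))"
      by auto
    define S where "S = span (\<Union>\<W>)"
    have subrep: "subrepresentation W" if "W \<in> \<W>" for W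
      using \<W>(2) that by (auto simp: irreducible_subrepresentation_def)
    have subspS: "subspace S" by (simp add: S_def)
    show ?case
    proof (cases "S = UNIV")
      case True
      then show ?thesis using \<W> Suc.prems unfolding S_def by (intro exI[of _ \<W>]) simp
    next
      case False
      obtain C where C: "subrepresentation C" "S \<inter> C = {0}" "\<And>v. \<exists>w\<in>S. \<exists>u\<in>C. v = w + u"
        using exists_complement[OF _ subrepresentation_span_Union[OF subrep]] diag
        unfolding S_def diagonalizable_iff_span_eigenvectors by blast
      have "C \<noteq> {0}"
      proof
        assume "C = {0}"
        then have "v \<in> S" for v using C(3)[of v] by auto
        then show False using False by auto
      qed
      then obtain I where I: "irreducible_subrepresentation I" "I \<subseteq> C" "I \<noteq> {0}"
        using exists_irreducible_subrepresentation C(1) by blast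
      have subspI: "subspace I"
        using I(1) by (simp add: irreducible_subrepresentation_def subrepresentation_def)
      have SI: "S \<inter> I \<subseteq> {0}" using C(2) I(2) by blast
      have notin: "\<not> I \<subseteq> S"
        using SI I(3) subspace_0[OF subspI] by blast
      then have "I \<notin> \<W>" using span_superset[of "\<Union>\<W>"] by (auto simp: S_def)
      have "independent_subspaces (insert I \<W>)"
        unfolding independent_subspaces_def
      proof (intro allI impI)
        fix w assume w: "(\<forall>U\<in>insert I \<W>. w U \<in> U) \<and> sum w (insert I \<W>) = 0"
        then have eq: "w I + sum w \<W> = 0" using \<open>I \<notin> \<W>\<close> \<W>(1) by simp
        have "sum w \<W> \<in> S"
          unfolding S_def using w by (intro span_sum span_base) auto
        then have "w I \<in> S"
          using eq subspace_neg[OF subspS] by (simp add: eq_neg_iff_add_eq_0[symmetric])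
        then have "w I = 0" using w SI by auto
        moreover have "\<forall>U\<in>\<W>. w U = 0"
          using \<W>(3)[unfolded independent_subspaces_def, rule_format, of w] w eq \<open>w I = 0\<close> by simp
        ultimately show "\<forall>U\<in>insert I \<W>. w U = 0" by simp
      qed
      moreover have "S \<subset> span (\<Union>(insert I \<W>))"
        using notin span_mono[of "\<Union>\<W>" "\<Union>(insert I \<W>)"] span_superset[of "\<Union>(insert I \<W>)"]
        by (auto simp: S_def)
      then have "dim (\<Union>\<W>) < dim (\<Union>(insert I \<W>))"
        unfolding S_def by (rule dim_psubset)
      then have "Suc k \<le> dim (span (\<Union>(insert I \<W>)))"
        using \<W>(4) by (simp only: dim_span)
      ultimately show ?thesis
        using \<W>(1,2) I(1) by (intro exI[of _ "insert I \<W>"]) auto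
    qed
  qed
  then obtain \<W> where \<W>: "finite \<W>" "\<forall>W\<in>\<W>. irreducible_subrepresentation W"
      "independent_subspaces \<W>" "dim (UNIV :: 'v set) \<le> dim (span (\<Union>\<W>))"
    by blast
  have "span (\<Union>\<W>) = UNIV"
    using \<W>(4) by (intro subspace_dim_equal) auto
  then show completely_reducible
    using direct_sum_decompositionI[of \<W>] \<W> unfolding completely_reducible_def
    by (auto simp: irreducible_subrepresentation_def subrepresentation_def)
qed

end

subsection \<open>Eigenvectors over the complex numbers\<close>

context vector_space
begin

definition poly_apply :: "'a poly \<Rightarrow> ('b \<Rightarrow> 'b) \<Rightarrow> 'b \<Rightarrow> 'b" where
  "poly_apply p f v = (\<Sum>i\<le>degree p. scale (coeff p i) ((f ^^ i) v))"

end

context vector_space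
begin

lemma poly_apply_bound:
  "degree p \<le> n \<Longrightarrow> poly_apply p f v = (\<Sum>i\<le>n. scale (coeff p i) ((f ^^ i) v))"
  unfolding poly_apply_def by (intro sum.mono_neutral_left) (auto simp: coeff_eq_0)

text \<open>Letting the linear factor act on the vector first reduces the degree of the remaining
  polynomial, which drives the induction in \<open>exists_eigenvector\<close>.\<close>

lemma poly_apply_linear_factor:
  assumes "Vector_Spaces.linear scale scale f"
  shows "poly_apply ([:-z, 1:] * q) f v = poly_apply q f (f v - scale z v)"
proof -
  define n where "n = Suc (degree q)"
  have fn: "Vector_Spaces.linear scale scale (f ^^ i)" for i
    by (rule linear_funpow[OF assms])
  have "degree ([:-z, 1:] * q) \<le> n"
    using degree_mult_le[of "[:-z, 1:]" q] by (simp add: n_def)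
  then have "poly_apply ([:-z, 1:] * q) f v = (\<Sum>i\<le>n. scale (coeff ([:-z, 1:] * q) i) ((f ^^ i) v))"
    by (rule poly_apply_bound)
  also have "\<dots> = (\<Sum>i\<le>n. scale (coeff (pCons 0 q) i) ((f ^^ i) v)) -
      (\<Sum>i\<le>n. scale (z * coeff q i) ((f ^^ i) v))"
    by (simp add: sum_subtractf[symmetric] scale_left_diff_distrib[symmetric])
  also have "(\<Sum>i\<le>n. scale (coeff (pCons 0 q) i) ((f ^^ i) v)) = poly_apply q f (f v)"
    unfolding n_def sum.atMost_Suc_shift poly_apply_def by (simp add: funpow_swap1)
  also have "(\<Sum>i\<le>n. scale (z * coeff q i) ((f ^^ i) v)) = poly_apply q f (scale z v)"
    using fn poly_apply_bound[of q n f "scale z v"]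
    by (simp add: n_def Vector_Spaces.linear_iff mult.commute)
  also have "poly_apply q f (f v) - poly_apply q f (scale z v) = poly_apply q f (f v - scale z v)"
  proof -
    have "(f ^^ i) (f v - scale z v) = (f ^^ i) (f v) - (f ^^ i) (scale z v)" for i
    proof -
      interpret g: Vector_Spaces.linear scale scale "f ^^ i" by (rule fn)
      show ?thesis by (rule g.diff)
    qed
    then show ?thesis
      by (simp add: poly_apply_def sum_subtractf[symmetric] scale_right_diff_distrib)
  qed
  finally show ?thesis .
qed

end

context finite_dimensional_vector_space
begin

text \<open>With \<open>n\<close> the dimension, the \<open>n + 1\<close> vectors
  \<open>(f ^^ i) v\<close> for \<open>i \<le> n\<close> satisfy a nontrivial linear relation, whose
  coefficients are those of \<open>p\<close>.\<close>

lemma exists_annihilating_poly: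
  obtains p where "p \<noteq> 0" "poly_apply p f v = 0"
proof -
  define n where "n = card Basis"
  define g where "g i = (f ^^ i) v" for i
  have "\<exists>c. (\<exists>i\<le>n. c i \<noteq> 0) \<and> (\<Sum>i\<le>n. scale (c i) (g i)) = 0"
  \<comment> \<open>Dependence is a property of the set of vectors. If two members of the family
    coincide, that set is too small for the counting argument, but their difference is already a
    relation.\<close>
  proof (cases "inj_on g {..n}")
    case True
    have "card (g ` {..n}) > n" using True by (simp add: card_image)
    then have "dependent (g ` {..n})"
      using independent_bound_general[of "g ` {..n}"] dim_subset_UNIV[of "g ` {..n}"]
      by (auto simp: n_def dimension_def)
    then obtain u where "\<exists>w\<in>g ` {..n}. u w \<noteq> 0" "(\<Sum>w\<in>g ` {..n}. scale (u w) w) = 0"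
      using dependent_finite[of "g ` {..n}"] by auto
    then show ?thesis
      by (intro exI[of _ "u \<circ> g"]) (auto simp: sum.reindex[OF True])
  next
    case False
    then obtain i j where ij: "i \<le> n" "j \<le> n" "i \<noteq> j" "g i = g j"
      by (auto simp: inj_on_def)
    have "(\<Sum>k\<le>n. scale ((if k = i then 1 else 0) - (if k = j then 1 else 0)) (g k)) =
      (\<Sum>k\<le>n. if k = i then g i else 0) - (\<Sum>k\<le>n. if k = j then g j else 0)"
      unfolding sum_subtractf[symmetric] by (rule sum.cong) (auto simp: scale_left_diff_distrib)
    then have "(\<Sum>k\<le>n. scale ((if k = i then 1 else 0) - (if k = j then 1 else 0)) (g k)) = 0"
      using ij by simp
    then show ?thesis
      using ij by (intro exI[of _ "\<lambda>k. (if k = i then 1 else 0) - (if k = j then 1 else 0)"]) auto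
  qed
  then obtain c i where c: "i \<le> n" "c i \<noteq> 0" "(\<Sum>i\<le>n. scale (c i) (g i)) = 0"
    by blast
  define p where "p = (\<Sum>i\<le>n. monom (c i) i)"
  have coeff_p: "coeff p k = (if k \<le> n then c k else 0)" for k
    by (simp add: p_def coeff_sum coeff_monom)
  have "p \<noteq> 0"
    using c(1,2) coeff_p[of i] by auto
  moreover have "degree p \<le> n"
    by (rule degree_le) (simp add: coeff_p)
  then have "poly_apply p f v = 0"
    using c(3) by (simp add: poly_apply_bound coeff_p g_def)
  ultimately show thesis by (rule that)
qed

end

section \<open>Complex eigenvectors and Schur's lemma\<close>

text \<open>Induction on the degree of a polynomial annihilating \<open>v\<close>: for a root
  \<open>z\<close>, either \<open>v\<close> is an eigenvector for \<open>z\<close>, or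
  \<open>f v - scale z v\<close> is a nonzero vector of \<open>U\<close> annihilated by the quotient
  of lower degree.\<close>

lemma exists_eigenvector:
  fixes scale :: "complex \<Rightarrow> 'v::ab_group_add \<Rightarrow> 'v"
  assumes "finite_dimensional_vector_space scale Basis"
    and f: "Vector_Spaces.linear scale scale f"
    and U: "module.subspace scale U" "f ` U \<subseteq> U" "U \<noteq> {0}"
  obtains v c where "v \<in> U" "v \<noteq> 0" "f v = scale c v"
proof -
  interpret finite_dimensional_vector_space scale Basis by fact
  have "\<exists>v\<in>U. \<exists>c. v \<noteq> 0 \<and> f v = scale c v"
    if "p \<noteq> 0" "v \<in> U" "v \<noteq> 0" "poly_apply p f v = 0" for p v
    using that
  proof (induction "degree p" arbitrary: p v)
    case 0
    then obtain a where "p = [:a:]" by (metis degree_eq_zeroE)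
    with 0 show ?case by (simp add: poly_apply_def)
  next
    case (Suc n)
    then have "\<not> constant (poly p)" by (simp add: constant_degree)
    then obtain z where "poly p z = 0" using fundamental_theorem_of_algebra by blast
    then obtain q where q: "p = [:-z, 1:] * q" by (auto simp: poly_eq_0_iff_dvd)
    then have "q \<noteq> 0" using Suc.prems by auto
    then have "n = degree q" using Suc.hyps(2) unfolding q by (subst (asm) degree_mult_eq) auto
    show ?case
    proof (cases "f v - scale z v = 0")
      case True
      then show ?thesis using Suc.prems by auto
    next
      case False
      have "f v - scale z v \<in> U"
        using Suc.prems U by (auto intro!: subspace_diff subspace_scale)
      moreover have "poly_apply q f (f v - scale z v) = 0"
        using Suc.prems(4) unfolding q poly_apply_linear_factor[OF f] .
      ultimately show ?thesis
        using Suc.hyps(1)[OF \<open>n = degree q\<close> \<open>q \<noteq> 0\<close>] False by blast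
    qed
  qed
  moreover obtain v where "v \<in> U" "v \<noteq> 0"
    using U subspace_0 by blast
  ultimately show thesis
    using exists_annihilating_poly[of f v] that by metis
qed

text \<open>The components of \<open>u\<close> are obtained by a discrete Fourier transform
  over the \<open>N\<close>-th roots of \<open>c\<close>.\<close>
lemma span_eigenvectors_if_power_scalar:
  fixes scale :: "complex \<Rightarrow> 'v::ab_group_add \<Rightarrow> 'v"
  assumes "vector_space scale"
    and f: "Vector_Spaces.linear scale scale f"
    and N: "N > 0" and u: "(f ^^ N) u = scale c u" and c: "c \<noteq> 0"
  shows "u \<in> module.span scale (vector_space.eigenvectors scale f)"
proof -
  interpret vector_space scale by fact
  interpret f: Vector_Spaces.linear scale scale f by fact
  have "card {z. z ^ N = c} > 0"
    using card_nth_roots[OF c N] N by simp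
  then obtain z where z: "z ^ N = c"
    by (metis (mono_tags, lifting) card.empty empty_Collect_eq less_irrefl)
  then have z0: "z \<noteq> 0" using c N by auto
  \<comment> \<open>A primitive \<open>N\<close>-th root of unity; the numbers
    \<open>\<zeta> j\<close> for \<open>j < N\<close> are then the \<open>N\<close>-th roots of
    \<open>c\<close>.\<close>
  define \<omega> where "\<omega> = cis (2 * pi / real N)"
  have \<omega>0: "\<omega> \<noteq> 0" by (simp add: \<omega>_def)
  have \<omega>_pow: "\<omega> ^ k = cis (2 * pi * real k / real N)" for k
    by (simp add: \<omega>_def DeMoivre mult_ac)
  have \<omega>N: "\<omega> ^ N = 1" using N by (simp add: \<omega>_pow)
  have \<omega>_prim: "\<omega> ^ k \<noteq> 1" if "0 < k" "k < N" for k
  proof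
    assume "\<omega> ^ k = 1"
    then have "\<omega> ^ k = \<omega> ^ 0" by simp
    then show False
      using inj_onD[OF bij_betw_imp_inj_on[OF bij_betw_roots_unity[OF N]], of k 0] that
      unfolding \<omega>_pow by simp
  qed
  define \<zeta> where "\<zeta> j = z * \<omega> ^ j" for j
  have \<zeta>0: "\<zeta> j \<noteq> 0" for j using z0 \<omega>0 by (simp add: \<zeta>_def)
  have \<zeta>N: "\<zeta> j ^ N = c" for j
  proof -
    have "(\<omega> ^ j) ^ N = (\<omega> ^ N) ^ j" by (simp add: power_mult[symmetric] mult.commute)
    then show ?thesis using z \<omega>N by (simp add: \<zeta>_def power_mult_distrib)
  qed
  \<comment> \<open>Up to the factor \<open>N\<close>, the sum of \<open>h j k\<close> over
    \<open>k < N\<close> is the component of \<open>u\<close> for the eigenvalue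
    \<open>\<zeta> j\<close>.\<close>
  define h where "h j k = scale (inverse (\<zeta> j) ^ k) ((f ^^ k) u)" for j k
  have "(\<Sum>k<N. h j k) \<in> eigenvectors f" for j
  proof -
    have fh: "f (h j k) = scale (\<zeta> j) (h j (Suc k))" for k
      using \<zeta>0[of j] by (simp add: h_def f.scale)
    \<comment> \<open>The scalar \<open>c\<close> coming from \<open>(f ^^ N) u\<close> cancels
      against \<open>inverse (\<zeta> j) ^ N\<close>. Hence \<open>f\<close> permutes the summands
      cyclically, up to the factor \<open>\<zeta> j\<close>.\<close>
    have "h j N = h j 0"
      using \<zeta>N[of j] c u by (simp add: h_def power_inverse)
    then have "(\<Sum>k<N. h j (Suc k)) = (\<Sum>k<N. h j k)"
      using sum.lessThan_Suc_shift[of "h j" N] by simp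
    then have "f (\<Sum>k<N. h j k) = scale (\<zeta> j) (\<Sum>k<N. h j k)"
      by (simp add: f.sum fh scale_sum_right[symmetric])
    then show ?thesis by (auto simp: eigenvectors_def)
  qed
  then have "(\<Sum>j<N. \<Sum>k<N. h j k) \<in> span (eigenvectors f)"
    by (intro span_sum span_base)
  also have "(\<Sum>j<N. \<Sum>k<N. h j k) = (\<Sum>k<N. \<Sum>j<N. h j k)"
    by (rule sum.swap)
  \<comment> \<open>For \<open>0 < k < N\<close> the sum over \<open>j\<close> is a full geometric
    sum of a nontrivial \<open>N\<close>-th root of unity and vanishes.\<close>
  also have "\<dots> = (\<Sum>k<N. if k = 0 then scale (of_nat N) u else 0)"
  proof (rule sum.cong[OF refl])
    fix k assume k: "k \<in> {..<N}"
    have "(\<Sum>j<N. h j k) = scale (inverse z ^ k * (\<Sum>j<N. (inverse \<omega> ^ k) ^ j)) ((f ^^ k) u)"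
      unfolding sum_distrib_left scale_sum_left
      by (rule sum.cong) (simp_all add: h_def \<zeta>_def power_mult_distrib power_inverse power_mult[symmetric] mult.commute)
    also have "\<dots> = (if k = 0 then scale (of_nat N) u else 0)"
    proof (cases "k = 0")
      case False
      then have "inverse \<omega> ^ k \<noteq> 1"
        using \<omega>_prim[of k] k by (simp add: power_inverse)
      moreover have "(inverse \<omega> ^ k) ^ N = 1"
      proof -
        have "(inverse \<omega> ^ k) ^ N = inverse (\<omega> ^ N) ^ k"
          by (simp add: power_inverse power_mult[symmetric] mult.commute)
        then show ?thesis by (simp add: \<omega>N)
      qed
      ultimately show ?thesis
        using False by (simp add: geometric_sum)
    qed simp
    finally show "(\<Sum>j<N. h j k) = (if k = 0 then scale (of_nat N) u else 0)" .
  qed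
  also have "\<dots> = scale (of_nat N) u"
    using N by simp
  finally have "scale (inverse (of_nat N)) (scale (of_nat N) u) \<in> span (eigenvectors f)"
    by (rule span_scale)
  then show ?thesis using N by simp
qed

text \<open>Schur's lemma makes the central power \<open>\<rho> x ^^ N\<close> a nonzero scalar on each
  irreducible summand.\<close>
lemma diagonalizable_if_completely_reducible:
  fixes scale :: "complex \<Rightarrow> 'v::ab_group_add \<Rightarrow> 'v"
  assumes "finite_dimensional_finite_quandle_representation Q qop scale \<rho> Basis"
    and cr: "quandle_representation.completely_reducible Q scale \<rho>" and x: "x \<in> Q"
  shows "vector_space.diagonalizable scale (\<rho> x)"
proof -
  interpret finite_dimensional_finite_quandle_representation Q qop scale \<rho> Basis by fact
  obtain N where N: "N > 0"
    and central: "\<And>x y. x \<in> Q \<Longrightarrow> y \<in> Q \<Longrightarrow> (\<rho> x ^^ N) \<circ> \<rho> y = \<rho> y \<circ> (\<rho> x ^^ N)"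
    using exists_central_exponent by blast
  define T where "T = \<rho> x ^^ N"
  have T: "Vector_Spaces.linear scale scale T"
    unfolding T_def by (rule linear_funpow[OF rep_linear[OF x]])
  interpret T: Vector_Spaces.linear scale scale T by (fact T)
  have inj: "inj T"
    unfolding T_def using bij_is_inj[OF rep_bij[OF x]] by (rule inj_fn)
  obtain \<W> where \<W>: "\<And>W. W \<in> \<W> \<Longrightarrow> irreducible_subrepresentation W" "direct_sum_decomposition \<W>"
    using cr unfolding completely_reducible_def by blast
  have "\<Union>\<W> \<subseteq> span (eigenvectors (\<rho> x))"
  proof
    fix w assume "w \<in> \<Union>\<W>"
    then obtain W where W: "W \<in> \<W>" "w \<in> W" by blast
    have irr: "subrepresentation W" "\<And>U. subrepresentation U \<Longrightarrow> U \<subseteq> W \<Longrightarrow> U = {0} \<or> U = W"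
      using \<W>(1)[OF W(1)] by (auto simp: irreducible_subrepresentation_def)
    then have subW: "subspace W" and WW: "\<And>y. y \<in> Q \<Longrightarrow> \<rho> y ` W \<subseteq> W"
      by (auto simp: subrepresentation_def)
    show "w \<in> span (eigenvectors (\<rho> x))"
    proof (cases "W = {0}")
      case True
      then show ?thesis using W span_zero by simp
    next
      case False
      have TW: "T ` W \<subseteq> W"
      proof -
        have "(\<rho> x ^^ n) ` W \<subseteq> W" for n
          using WW[OF x] by (induction n) (auto simp: image_subset_iff)
        then show ?thesis by (simp add: T_def)
      qed
      obtain v c where v: "v \<in> W" "v \<noteq> 0" "T v = scale c v"
        using exists_eigenvector[OF finite_dimensional_vector_space_axioms T subW TW False] by blast
      \<comment> \<open>An eigenspace of \<open>T\<close> in \<open>W\<close> is a subrepresentation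
        because \<open>T\<close> commutes with all \<open>\<rho> y\<close>. Being nonzero, it is all
        of the irreducible \<open>W\<close>.\<close>
      define K where "K = {u \<in> W. T u = scale c u}"
      have "subrepresentation K"
        unfolding subrepresentation_def
      proof (intro conjI ballI)
        show "subspace K"
          using subW by (auto simp: K_def subspace_def T.zero T.add T.scale scale_right_distrib
              scale_left_commute simp del: scale_scale)
        fix f assume "f \<in> \<rho> ` Q"
        then obtain y where y: "y \<in> Q" "f = \<rho> y" by blast
        interpret f: Vector_Spaces.linear scale scale "\<rho> y" using rep_linear[OF y(1)] .
        have "T (f u) = f (T u)" for u
          using central[OF x y(1)] y(2) by (simp add: T_def fun_eq_iff)
        then show "f ` K \<subseteq> K"
          using WW[OF y(1)] y(2) by (auto simp: K_def f.scale)
      qed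
      moreover have "K \<subseteq> W" "v \<in> K" using v by (auto simp: K_def)
      ultimately have "K = W" using irr(2) v(2) by blast
      then have "T w = scale c w" using W(2) by (auto simp: K_def)
      \<comment> \<open>A nonzero \<open>c\<close> has \<open>N\<close> distinct \<open>N\<close>-th
        roots; for \<open>c = 0\<close> the map \<open>\<rho> x\<close> could be nilpotent on
        \<open>W\<close>, which injectivity of \<open>T\<close> excludes.\<close>
      moreover have "c \<noteq> 0"
      proof
        assume "c = 0"
        then have "T v = T 0" using v(3) T.zero by simp
        then show False using inj v(2) by (simp add: inj_def)
      qed
      ultimately show ?thesis
        using span_eigenvectors_if_power_scalar[OF vector_space_axioms rep_linear[OF x] N]
        by (simp add: T_def)
    qed
  qed
  then have "span (\<Union>\<W>) \<subseteq> span (eigenvectors (\<rho> x))"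
    by (rule span_minimal) simp
  then show ?thesis
    using direct_sum_decomposition_span[OF \<W>(2)]
    unfolding diagonalizable_iff_span_eigenvectors by auto
qed

theorem theorem2p11:
  fixes Q :: "'q set" and qop :: "'q \<Rightarrow> 'q \<Rightarrow> 'q"
    and scale :: "complex \<Rightarrow> 'v::ab_group_add \<Rightarrow> 'v" and Basis :: "'v set"
    and \<rho> :: "'q \<Rightarrow> 'v \<Rightarrow> 'v"
  assumes "quandle_representation Q qop scale \<rho>"
    and "finite Q"
    and "finite_dimensional_vector_space scale Basis"
  shows "quandle_representation.completely_reducible Q scale \<rho> \<longleftrightarrow>
    (\<forall>f\<in>\<rho> ` Q. vector_space.diagonalizable scale f)"
proof -
  have loc: "finite_dimensional_finite_quandle_representation Q qop scale \<rho> Basis"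
    using assms by (simp add: finite_dimensional_finite_quandle_representation_def
        finite_quandle_representation_def finite_quandle_representation_axioms_def)
  show ?thesis
    using diagonalizable_if_completely_reducible[OF loc]
      finite_dimensional_finite_quandle_representation.completely_reducible_if_diagonalizable[OF loc]
    by blast
qed

end
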